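(* Let $\mathcal{R}$ be a commutative ring containing $\mathbb{Q}$, let $F(x_0)\in\mathcal{R}[[x_0]]$ be a formal power series in one variable, and let $n\ge 1$. Then $$(\Delta_nF)(x_0,x_1,\dots,x_n)=\sum_{k=1}^nF^{(k)}(x_0)\,B_{n,k}(x_1,x_2,\dots,x_n).$$
   Context: For $m\ge1$, $\mathcal{D}_m:\mathcal{R}[[x_0,\dots,x_{m-1}]]\to\mathcal{R}[[x_0,\dots,x_m]]$ is the operator $\mathcal{D}_m=\sum_{j=0}^{m-1}x_{j+1}\partial_j$, where $\partial_j=\partial/\partial x_j$, and $\Delta_n=\mathcal{D}_n\mathcal{D}_{n-1}\cdots\mathcal{D}_1$. $F^{(k)}$ is the $k$-th derivative of $F$. $B_{n,k}$ is the partial Bell polynomial $B_{n,k}(x_1,\dots,x_n)=\sum_{\pi}\prod_{B\in\pi}x_{|B|}$, the sum being over all set partitions $\pi$ of $[n]=\{1,\dots,n\}$ with exactly $k$ blocks. *)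

theory Defs
  imports
    "HOL-Library.Poly_Mapping"
    "HOL-Library.Disjoint_Sets"
    "HOL-Computational_Algebra.Formal_Power_Series"
begin

section \<open>Multivariate formal power series\<close>

text \<open>
  A monomial in the variables \<open>x\<^sub>0, x\<^sub>1, \<dots>\<close> is a finitely supported exponent function.  A
  power series is an arbitrary family of coefficients indexed by monomials.  The ring
  \<open>R[[x\<^sub>0, \<dots>, x\<^sub>m]]\<close> is the subring \<open>mfps_in m\<close> below, so that the rings for different
  \<open>m\<close> live in one type and the inclusions between them are identities.
\<close>

type_synonym monom = "nat \<Rightarrow>\<^sub>0 nat"

abbreviation expo :: "monom \<Rightarrow> nat \<Rightarrow> nat" where "expo \<equiv> Poly_Mapping.lookup"
abbreviation vars :: "monom \<Rightarrow> nat set" where "vars \<equiv> Poly_Mapping.keys"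
abbreviation var :: "nat \<Rightarrow> monom" where "var j \<equiv> Poly_Mapping.single j 1"

typedef 'a mfps = "UNIV :: (monom \<Rightarrow> 'a) set"
  morphisms mcoeff Abs_mfps ..

lemma mcoeff_Abs [simp]: "mcoeff (Abs_mfps f) = f"
  by (simp add: Abs_mfps_inverse)

lemma mfps_eqI: "(\<And>m. mcoeff f m = mcoeff g m) \<Longrightarrow> f = g"
  by (metis ext mcoeff_inject)

definition splits :: "monom \<Rightarrow> (monom \<times> monom) set" where
  "splits m = {(a, b). a + b = m}"

lemma finite_splits [simp, intro]: "finite (splits m)"
proof -
  let ?B = "{..Max (insert 0 (expo m ` vars m))}"
  let ?S = "{f. \<forall>x. (x \<in> vars m \<longrightarrow> f x \<in> ?B) \<and> (x \<notin> vars m \<longrightarrow> f x = 0)}"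
  have fin: "finite ?S"
    by (rule finite_set_of_finite_funs) auto
  have "expo a \<in> ?S" if "a + b = m" for a b
  proof -
    have le: "expo a x \<le> expo m x" for x
      using that by (auto simp: lookup_add)
    have "expo m x \<le> Max (insert 0 (expo m ` vars m))" if "x \<in> vars m" for x
      using that by (intro Max_ge) auto
    with le have "expo a x \<in> ?B" if "x \<in> vars m" for x
      using that order_trans by blast
    moreover have "expo a x = 0" if "x \<notin> vars m" for x
      using le[of x] that by (simp add: in_keys_iff)
    ultimately show ?thesis by blast
  qed
  then have "expo ` fst ` splits m \<subseteq> ?S"
    by (auto simp: splits_def)
  then have "finite (expo ` fst ` splits m)"
    using fin finite_subset by blast
  then have "finite (fst ` splits m)"
    by (rule finite_imageD) (auto intro!: inj_onI poly_mapping_eqI)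
  moreover have "inj_on fst (splits m)"
    by (auto simp: inj_on_def splits_def)
  ultimately show ?thesis
    by (rule finite_imageD)
qed

instantiation mfps :: (comm_ring_1) comm_ring_1
begin

definition "0 = Abs_mfps (\<lambda>_. 0)"
definition "1 = Abs_mfps (\<lambda>m. if m = 0 then 1 else 0)"
definition "f + g = Abs_mfps (\<lambda>m. mcoeff f m + mcoeff g m)"
definition "f - g = Abs_mfps (\<lambda>m. mcoeff f m - mcoeff g m)"
definition "- f = Abs_mfps (\<lambda>m. - mcoeff f m)"
definition "f * g = Abs_mfps (\<lambda>m. \<Sum>(a, b)\<in>splits m. mcoeff f a * mcoeff g b)"

instance
proof
  fix f g h :: "'a mfps"
  show "f * g * h = f * (g * h)"
  proof (rule mfps_eqI)
    fix m
    have "mcoeff (f * g * h) m =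
        (\<Sum>(a, b)\<in>splits m. \<Sum>(c, d)\<in>splits a. mcoeff f c * mcoeff g d * mcoeff h b)"
      by (simp add: times_mfps_def sum_distrib_right case_prod_unfold)
    also have "\<dots> = (\<Sum>(p, q)\<in>Sigma (splits m) (\<lambda>p. splits (fst p)).
        mcoeff f (fst q) * mcoeff g (snd q) * mcoeff h (snd p))"
      by (simp add: sum.Sigma case_prod_unfold)
    also have "\<dots> = (\<Sum>(p, q)\<in>Sigma (splits m) (\<lambda>p. splits (snd p)).
        mcoeff f (fst p) * (mcoeff g (fst q) * mcoeff h (snd q)))"
      by (rule sum.reindex_bij_witness
          [where i = "\<lambda>(p, q). ((fst p + fst q, snd q), (fst p, fst q))"
             and j = "\<lambda>(p, q). ((fst q, snd q + snd p), (snd q, snd p))"])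
        (auto simp: splits_def algebra_simps)
    also have "\<dots> = (\<Sum>(a, b)\<in>splits m. \<Sum>(c, d)\<in>splits b. mcoeff f a * (mcoeff g c * mcoeff h d))"
      by (simp add: sum.Sigma case_prod_unfold)
    also have "\<dots> = mcoeff (f * (g * h)) m"
      by (simp add: times_mfps_def sum_distrib_left case_prod_unfold)
    finally show "mcoeff (f * g * h) m = mcoeff (f * (g * h)) m" .
  qed
  show "f * g = g * f"
  proof (rule mfps_eqI)
    fix m
    show "mcoeff (f * g) m = mcoeff (g * f) m"
      unfolding times_mfps_def mcoeff_Abs
      by (rule sum.reindex_bij_witness[where i = prod.swap and j = prod.swap])
        (auto simp: splits_def algebra_simps)
  qed
  show "1 * f = f"
  proof (rule mfps_eqI)
    fix m
    have zero_m: "(0, m) \<in> splits m"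
      by (simp add: splits_def)
    have "mcoeff (1 * f) m = (\<Sum>p\<in>splits m. if p = (0, m) then mcoeff f m else 0)"
      unfolding times_mfps_def one_mfps_def mcoeff_Abs
      by (rule sum.cong) (auto simp: splits_def split: if_splits)
    then show "mcoeff (1 * f) m = mcoeff f m"
      using zero_m by simp
  qed
  show "(f + g) * h = f * h + g * h"
    by (rule mfps_eqI)
      (simp add: times_mfps_def plus_mfps_def case_prod_unfold distrib_right sum.distrib)
  show "f + g + h = f + (g + h)" "f + g = g + f" "0 + f = f" "- f + f = 0" "f - g = f + - g"
    by (rule mfps_eqI; simp add: plus_mfps_def zero_mfps_def uminus_mfps_def minus_mfps_def
        algebra_simps)+
  have "mcoeff (0 :: 'a mfps) 0 \<noteq> mcoeff 1 0"
    by (simp add: zero_mfps_def one_mfps_def)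
  then show "(0 :: 'a mfps) \<noteq> 1"
    by metis
qed

end

definition mfps_in :: "nat \<Rightarrow> 'a::comm_ring_1 mfps set" where
  "mfps_in m = {f. \<forall>a. mcoeff f a \<noteq> 0 \<longrightarrow> vars a \<subseteq> {..m}}"

definition mX :: "nat \<Rightarrow> 'a::comm_ring_1 mfps" where
  "mX j = Abs_mfps (\<lambda>a. if a = var j then 1 else 0)"

text \<open>The partial derivative \<open>\<partial>\<^sub>j\<close>: termwise, \<open>x\<^sup>b\<close> goes to \<open>b\<^sub>j x\<^sup>b / x\<^sub>j\<close>.\<close>

definition mderiv :: "nat \<Rightarrow> 'a::comm_ring_1 mfps \<Rightarrow> 'a mfps" where
  "mderiv j f = Abs_mfps (\<lambda>a. of_nat (expo a j + 1) * mcoeff f (a + var j))"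

text \<open>The embedding of \<open>R[[x\<^sub>0]]\<close>, i.e. \<open>F \<mapsto> F(x\<^sub>0)\<close>.\<close>

definition mfps_of_fps :: "'a::comm_ring_1 fps \<Rightarrow> 'a mfps" where
  "mfps_of_fps F =
     Abs_mfps (\<lambda>a. if vars a \<subseteq> {0} then fps_nth F (expo a 0) else 0)"


section \<open>The operators and the Bell polynomials\<close>

definition D_op :: "nat \<Rightarrow> 'a::comm_ring_1 mfps \<Rightarrow> 'a mfps" where
  "D_op m f = (\<Sum>j<m. mX (Suc j) * mderiv j f)"

primrec Delta :: "nat \<Rightarrow> 'a::comm_ring_1 mfps \<Rightarrow> 'a mfps" where
  "Delta 0 f = f"
| "Delta (Suc n) f = D_op (Suc n) (Delta n f)"

definition Bell_poly :: "nat \<Rightarrow> nat \<Rightarrow> (nat \<Rightarrow> 'b::comm_semiring_1) \<Rightarrow> 'b" where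
  "Bell_poly n k x = (\<Sum>\<pi> | partition_on {1..n} \<pi> \<and> card \<pi> = k. \<Prod>B\<in>\<pi>. x (card B))"

text \<open>
  A commutative ring contains the rationals iff it admits an injective unital ring homomorphism
  from them.
\<close>

definition ring_embedding :: "('a::ring_1 \<Rightarrow> 'b::ring_1) \<Rightarrow> bool" where
  "ring_embedding h \<longleftrightarrow> inj h \<and> h 1 = 1 \<and>
     (\<forall>a b. h (a + b) = h a + h b) \<and> (\<forall>a b. h (a * b) = h a * h b)"


section \<open>Domains and codomains\<close>

lemma mfps_of_fps_in: "mfps_of_fps F \<in> mfps_in 0"
  by (auto simp: mfps_in_def mfps_of_fps_def split: if_splits)

lemma mfps_in_mono: "m \<le> n \<Longrightarrow> mfps_in m \<subseteq> mfps_in n"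
  by (fastforce simp: mfps_in_def)

lemma mX_in: "j \<le> m \<Longrightarrow> mX j \<in> mfps_in m"
  by (auto simp: mfps_in_def mX_def split: if_splits)

lemma keys_add_monom: "vars (a + b) = vars a \<union> vars (b :: monom)"
  by (auto simp: in_keys_iff lookup_add)

lemma mult_in: "f \<in> mfps_in m \<Longrightarrow> g \<in> mfps_in m \<Longrightarrow> f * g \<in> mfps_in m"
proof -
  assume f: "f \<in> mfps_in m" and g: "g \<in> mfps_in m"
  have "vars c \<subseteq> {..m}" if "mcoeff (f * g) c \<noteq> 0" for c
  proof -
    from that obtain p where "p \<in> splits c" "mcoeff f (fst p) * mcoeff g (snd p) \<noteq> 0"
      unfolding times_mfps_def mcoeff_Abs case_prod_unfold by (rule sum.not_neutral_contains_not_neutral)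
    moreover from this have "mcoeff f (fst p) \<noteq> 0" "mcoeff g (snd p) \<noteq> 0"
      by auto
    ultimately have "fst p + snd p = c" "vars (fst p) \<subseteq> {..m}" "vars (snd p) \<subseteq> {..m}"
      using f g by (auto simp: splits_def mfps_in_def)
    then show ?thesis by (auto simp: keys_add_monom)
  qed
  then show ?thesis by (simp add: mfps_in_def)
qed

lemma sum_in: "(\<And>i. i \<in> A \<Longrightarrow> f i \<in> mfps_in m) \<Longrightarrow> sum f A \<in> mfps_in m"
proof (induction A rule: infinite_finite_induct)
  case (insert x A)
  then have "f x \<in> mfps_in m" "sum f A \<in> mfps_in m" by auto
  then have "f x + sum f A \<in> mfps_in m"
    by (simp add: mfps_in_def plus_mfps_def) (metis add.right_neutral)
  with insert show ?case by simp
qed (auto simp: mfps_in_def zero_mfps_def)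

lemma mderiv_in:
  assumes "f \<in> mfps_in m"
  shows "mderiv j f \<in> mfps_in m"
proof -
  have "vars a \<subseteq> {..m}" if "mcoeff (mderiv j f) a \<noteq> 0" for a
  proof -
    from that have "mcoeff f (a + var j) \<noteq> 0"
      unfolding mderiv_def mcoeff_Abs by (metis mult_zero_right)
    with assms have "vars (a + var j) \<subseteq> {..m}"
      unfolding mfps_in_def by blast
    then show ?thesis
      unfolding keys_add_monom by blast
  qed
  then show ?thesis by (simp add: mfps_in_def)
qed

lemma D_op_in: "f \<in> mfps_in m \<Longrightarrow> D_op (Suc m) f \<in> mfps_in (Suc m)"
  unfolding D_op_def
  using mfps_in_mono[of m "Suc m"]
  by (intro sum_in mult_in mX_in mderiv_in) auto

lemma Delta_in: "Delta n (mfps_of_fps F) \<in> mfps_in n"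
  by (induction n) (auto intro: mfps_of_fps_in D_op_in)

end

theory Submission
  imports Defs
begin

text \<open>
  Each \<open>D_op m\<close> is a derivation.  It sends \<open>F\<^sup>(\<^sup>k\<^sup>)(x\<^sub>0)\<close> to \<open>x\<^sub>1 F\<^sup>(\<^sup>k\<^sup>+\<^sup>1\<^sup>)(x\<^sub>0)\<close> and \<open>x\<^sub>j\<close> to
  \<open>x\<^sub>j\<^sub>+\<^sub>1\<close>, so on the term of a set partition of \<open>{1..n}\<close> the Leibniz rule mirrors the ways to
  insert \<open>n + 1\<close>: differentiating \<open>F\<^sup>(\<^sup>k\<^sup>)\<close> adds the singleton block, and differentiating the factor
  of a block enlarges that block.  Every partition of \<open>{1..n+1}\<close> arises exactly once in this way.
\<close>

section \<open>Partial derivatives of power series\<close>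

lemma mderiv_add: "mderiv j (f + g) = mderiv j f + mderiv j g"
  by (rule mfps_eqI) (simp add: mderiv_def plus_mfps_def algebra_simps)

lemma mderiv_0 [simp]: "mderiv j 0 = 0"
  by (rule mfps_eqI) (simp add: mderiv_def zero_mfps_def)

text \<open>Differentiation never reads a constant coefficient, which is why it kills
  \<open>1\<close>. The exponent is \<open>Suc k\<close> because the simplifier turns the
  \<open>1\<close> in \<open>var j\<close> into \<open>Suc 0\<close>.\<close>

lemma add_single_Suc_neq_0 [simp]: "(a :: monom) + Poly_Mapping.single j (Suc k) \<noteq> 0"
proof
  assume "a + Poly_Mapping.single j (Suc k) = 0"
  then have "expo (a + Poly_Mapping.single j (Suc k)) j = 0" by simp
  then show False by (simp add: lookup_add)
qed

lemma mderiv_1 [simp]: "mderiv j 1 = 0"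
  by (rule mfps_eqI) (simp add: mderiv_def zero_mfps_def one_mfps_def)

text \<open>Subtraction of exponents is truncated, so cancellation needs the monomial to be
  divisible by the variable.\<close>

lemma diff_var_add_var:
  assumes "expo a j \<noteq> 0"
  shows "a - var j + var j = a"
  using assms by (intro poly_mapping_eqI) (auto simp: lookup_add lookup_minus lookup_single when_def)

text \<open>One half of the Leibniz rule. Splits whose first part lacks the variable
  \<open>j\<close> carry weight 0; the others correspond to splits of \<open>m\<close> by removing
  one \<open>var j\<close> from the first part.\<close>

lemma sum_splits_add_var:
  "(\<Sum>p\<in>splits (m + var j). of_nat (expo (fst p) j) * mcoeff f (fst p) * mcoeff g (snd p)) =
     mcoeff (mderiv j f * g) m"
proof -
  have "(\<Sum>p\<in>splits (m + var j). of_nat (expo (fst p) j) * mcoeff f (fst p) * mcoeff g (snd p)) =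
     (\<Sum>p\<in>{p \<in> splits (m + var j). expo (fst p) j \<noteq> 0}.
       of_nat (expo (fst p) j) * mcoeff f (fst p) * mcoeff g (snd p))"
    by (rule sum.mono_neutral_right) auto
  also have "\<dots> = (\<Sum>p\<in>splits m.
       of_nat (expo (fst p) j + 1) * mcoeff f (fst p + var j) * mcoeff g (snd p))"
  proof (rule sum.reindex_bij_witness
      [where i = "\<lambda>(a, b). (a + var j, b)" and j = "\<lambda>(a, b). (a - var j, b)"], goal_cases)
    case (2 p)
    then obtain a b where p: "p = (a, b)" "a + b = m + var j" "expo a j \<noteq> 0"
      by (auto simp: splits_def)
    then have "a - var j + b + var j = m + var j"
      by (metis add.assoc add.commute diff_var_add_var)
    with p show ?case by (auto simp: splits_def)
  next
    case (1 p)
    then show ?case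
      using diff_var_add_var[of "fst p" j] by (auto simp: case_prod_unfold prod_eq_iff)
  next
    case (5 p)
    then have "expo (fst p - var j) j + 1 = expo (fst p) j"
      by (simp add: lookup_minus)
    with 5 show ?case
      using diff_var_add_var[of "fst p" j] by (simp add: case_prod_unfold)
  qed (auto simp: splits_def lookup_add algebra_simps)
  also have "\<dots> = mcoeff (mderiv j f * g) m"
    by (simp add: times_mfps_def mderiv_def case_prod_unfold)
  finally show ?thesis .
qed

text \<open>For a split of \<open>m + var j\<close>, the factor \<open>expo (m + var j) j\<close>
  brought down by differentiation is the sum of the exponents in the two parts; each exponent yields
  one Leibniz term.\<close>

lemma mderiv_mult: "mderiv j (f * g) = mderiv j f * g + f * mderiv j g"
proof (rule mfps_eqI)
  fix m
  have "mcoeff (mderiv j (f * g)) m =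
      (\<Sum>p\<in>splits (m + var j). of_nat (expo (m + var j) j) * (mcoeff f (fst p) * mcoeff g (snd p)))"
    by (simp add: mderiv_def times_mfps_def sum_distrib_left case_prod_unfold lookup_add)
  also have "\<dots> = (\<Sum>p\<in>splits (m + var j).
        of_nat (expo (fst p) j) * mcoeff f (fst p) * mcoeff g (snd p)
      + of_nat (expo (snd p) j) * mcoeff g (snd p) * mcoeff f (fst p))"
  proof (rule sum.cong, goal_cases)
    case (2 p)
    then have "m + var j = fst p + snd p" by (auto simp: splits_def)
    then show ?case by (simp only: lookup_add of_nat_add) (simp add: algebra_simps)
  qed simp
  also have "\<dots> = mcoeff (mderiv j f * g) m
      + (\<Sum>p\<in>splits (m + var j). of_nat (expo (snd p) j) * mcoeff g (snd p) * mcoeff f (fst p))"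
    by (simp only: sum.distrib sum_splits_add_var)
  also have "(\<Sum>p\<in>splits (m + var j). of_nat (expo (snd p) j) * mcoeff g (snd p) * mcoeff f (fst p)) =
      (\<Sum>p\<in>splits (m + var j). of_nat (expo (fst p) j) * mcoeff g (fst p) * mcoeff f (snd p))"
    by (rule sum.reindex_bij_witness[where i = prod.swap and j = prod.swap])
      (auto simp: splits_def add.commute)
  also have "\<dots> = mcoeff (f * mderiv j g) m"
    by (simp only: sum_splits_add_var mult.commute[of f])
  finally show "mcoeff (mderiv j (f * g)) m = mcoeff (mderiv j f * g + f * mderiv j g) m"
    by (simp add: plus_mfps_def)
qed

lemma mderiv_mX: "mderiv j (mX i) = (if i = j then 1 else 0)"
proof (rule mfps_eqI)
  fix a
  have "a + var j = var i \<longleftrightarrow> a = 0 \<and> i = j"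
  proof
    assume eq: "a + var j = var i"
    have "expo (a + var j) j = expo (var i) j" by (simp only: eq)
    then have "i = j" by (auto simp: lookup_add lookup_single when_def split: if_splits)
    with eq show "a = 0 \<and> i = j" by simp
  qed auto
  then show "mcoeff (mderiv j (mX i)) a = mcoeff (if i = j then 1 else 0 :: 'a mfps) a"
    by (auto simp: mderiv_def mX_def one_mfps_def zero_mfps_def)
qed

lemma mderiv_mfps_of_fps:
  "mderiv j (mfps_of_fps F) = (if j = 0 then mfps_of_fps (fps_deriv F) else 0)"
  by (rule mfps_eqI)
    (auto simp: mderiv_def mfps_of_fps_def zero_mfps_def keys_add_monom lookup_add)

section \<open>The operators \<open>D_op m\<close> as derivations\<close>

lemma D_op_add: "D_op m (f + g) = D_op m f + D_op m g"
  by (simp add: D_op_def mderiv_add algebra_simps sum.distrib)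

lemma D_op_0 [simp]: "D_op m 0 = 0"
  by (simp add: D_op_def)

lemma D_op_1 [simp]: "D_op m 1 = 0"
  by (simp add: D_op_def)

lemma D_op_sum: "D_op m (sum f A) = (\<Sum>i\<in>A. D_op m (f i))"
  by (induction A rule: infinite_finite_induct) (auto simp: D_op_add)

lemma D_op_mult: "D_op m (f * g) = D_op m f * g + f * D_op m g"
  by (simp add: D_op_def mderiv_mult algebra_simps sum.distrib sum_distrib_left)

lemma D_op_prod:
  assumes "finite A"
  shows "D_op m (prod f A) = (\<Sum>i\<in>A. D_op m (f i) * prod f (A - {i}))"
  using assms
proof (induction A rule: finite_induct)
  case (insert x A)
  have "f x * (\<Sum>i\<in>A. D_op m (f i) * prod f (A - {i})) =
      (\<Sum>i\<in>A. D_op m (f i) * prod f (insert x A - {i}))"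
    unfolding sum_distrib_left
  proof (rule sum.cong)
    fix i assume "i \<in> A"
    with insert.hyps have "insert x A - {i} = insert x (A - {i})" by auto
    with insert.hyps show "f x * (D_op m (f i) * prod f (A - {i})) =
        D_op m (f i) * prod f (insert x A - {i})"
      by (simp add: mult.left_commute)
  qed simp
  with insert show ?case by (simp add: D_op_mult)
qed simp

text \<open>The sum in \<open>D_op m\<close> stops at \<open>j = m - 1\<close>, hence the bound on
  \<open>i\<close>.\<close>

lemma D_op_mX:
  assumes "i < m"
  shows "D_op m (mX i) = mX (Suc i)"
proof -
  have "D_op m (mX i) = (\<Sum>j<m. if i = j then mX (Suc j) else 0)"
    unfolding D_op_def mderiv_mX by (rule sum.cong) auto
  with assms show ?thesis by simp
qed

lemma D_op_mfps_of_fps: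
  "D_op (Suc m) (mfps_of_fps F) = mX 1 * mfps_of_fps (fps_deriv F)"
proof -
  have "D_op (Suc m) (mfps_of_fps F) =
      (\<Sum>j<Suc m. if j = 0 then mX 1 * mfps_of_fps (fps_deriv F) else 0)"
    unfolding D_op_def mderiv_mfps_of_fps by (rule sum.cong) auto
  then show ?thesis by simp
qed

section \<open>Set partitions of a set with one added element\<close>

text \<open>Excluding \<open>{a}\<close> from \<open>P\<close> makes this an equivalence: otherwise
  \<open>P\<close> could already be a partition of \<open>insert a A\<close> with \<open>{a}\<close>
  as a block.\<close>

lemma partition_on_insert_singleton:
  assumes "a \<notin> A"
  shows "partition_on (insert a A) (insert {a} P) \<and> {a} \<notin> P \<longleftrightarrow> partition_on A P"
proof -
  have "partition_on (insert a A) (insert {a} P) \<longleftrightarrow> partition_on A P" if "a \<notin> \<Union>P"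
    using partition_on_insert[of "{a}" P "insert a A"] that assms by (simp add: disjnt_def)
  moreover have "a \<notin> \<Union>P" if "partition_on A P"
    using that assms partition_onD1 by metis
  moreover have "a \<notin> \<Union>P" if "partition_on (insert a A) (insert {a} P)" "{a} \<notin> P"
    using that by (fastforce simp: partition_on_def disjoint_def)
  ultimately show ?thesis by blast
qed

text \<open>Covers both directions of the bijection below: enlarging a block by the new element and
  deleting that element from its block.\<close>

lemma partition_on_replace_block:
  assumes "partition_on A P" "B \<in> P" "B' \<noteq> {}" "disjnt B' (A - B)"
  shows "partition_on (A - B \<union> B') (insert B' (P - {B}))"
proof -
  have "disjnt B (\<Union>(P - {B}))"
    using assms(1,2) by (fastforce simp: partition_on_def disjoint_def disjnt_def)
  then have P: "partition_on (A - B) (P - {B})"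
    using partition_on_insert[of B "P - {B}" A] assms(1,2) by (simp add: insert_absorb)
  then have "disjnt B' (\<Union>(P - {B}))"
    using assms(4) partition_onD1 by metis
  moreover have "A - B \<union> B' - B' = A - B"
    using assms(4) by (auto simp: disjnt_def)
  ultimately show ?thesis
    using partition_on_insert[of B' "P - {B}" "A - B \<union> B'"] P assms(3) by simp
qed

lemma partition_on_block_unique:
  assumes "partition_on A P" "C \<in> P" "a \<in> C"
  shows "{D \<in> P. a \<in> D} = {C}"
  using assms by (auto simp: partition_on_def disjoint_def)

text \<open>If \<open>a\<close> is not alone in its block, deleting it leaves a partition of
  \<open>A\<close> with one marked block \<open>B\<close>; adding \<open>a\<close> to the marked
  block undoes this.\<close>

lemma sum_partition_on_insert_block:
  assumes "finite A" "a \<notin> A"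
  shows "(\<Sum>R | partition_on (insert a A) R \<and> {a} \<notin> R. g R) =
    (\<Sum>P | partition_on A P. \<Sum>B\<in>P. g (insert (insert a B) (P - {B})))"
proof -
  \<comment> \<open>The union extracts the unique block containing \<open>a\<close>, from which
    \<open>a\<close> is then removed.\<close>
  define block where "block R = \<Union>{C \<in> R. a \<in> C} - {a}" for R
  let ?S = "Sigma {P. partition_on A P} (\<lambda>P. P)"
  let ?join = "\<lambda>(P, B). insert (insert a B) (P - {B})"
  let ?split = "\<lambda>R. (insert (block R) (R - {insert a (block R)}), block R)"
  have "(\<Sum>R | partition_on (insert a A) R \<and> {a} \<notin> R. g R) = (\<Sum>p\<in>?S. g (?join p))"
  proof (rule sum.reindex_bij_witness[where i = ?join and j = ?split])
    fix R assume "R \<in> {R. partition_on (insert a A) R \<and> {a} \<notin> R}"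
    then have R: "partition_on (insert a A) R" "{a} \<notin> R" by auto
    then obtain C where C: "C \<in> R" "a \<in> C"
      using partition_onD1 by blast
    have block: "block R = C - {a}"
      by (simp add: block_def partition_on_block_unique[OF R(1) C])
    have ins: "insert a (block R) = C"
      using C by (auto simp: block)
    have "C \<noteq> {a}" using C R(2) by auto
    with C have ne: "C - {a} \<noteq> {}" by blast
    have sub: "C \<subseteq> insert a A" using C R(1) partition_onD1 by blast
    have "partition_on (insert a A - C \<union> (C - {a})) (insert (C - {a}) (R - {C}))"
      by (rule partition_on_replace_block[OF R(1) C(1) ne]) (auto simp: disjnt_def)
    moreover have "insert a A - C \<union> (C - {a}) = A"
      using sub C(2) assms(2) by auto
    ultimately have "partition_on A (insert (C - {a}) (R - {C}))" by simp
    then show "?split R \<in> ?S" by (simp add: ins) (simp add: block)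
    \<comment> \<open>Otherwise the shrunken block would merge with an existing one, and rejoining
      would lose that block.\<close>
    have "C - {a} \<notin> R"
    proof
      assume "C - {a} \<in> R"
      moreover have "C - {a} \<noteq> C" "(C - {a}) \<inter> C \<noteq> {}" using C ne by auto
      ultimately show False
        using R(1) C(1) by (metis disjointD partition_onD2)
    qed
    then show eq: "?join (?split R) = R"
      unfolding prod.case ins using C by (auto simp: block)
    show "g (?join (?split R)) = g R" by (simp only: eq)
  next
    fix p assume "p \<in> ?S"
    then obtain P B where p: "p = (P, B)" and P: "partition_on A P" "B \<in> P" by auto
    have sub: "B \<subseteq> A" using P partition_onD1 by blast
    have notin: "a \<notin> D" if "D \<in> P" for D
      using P(1) assms(2) that partition_onD1 by blast
    have "partition_on (A - B \<union> insert a B) (?join p)"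
      unfolding p prod.case
      by (rule partition_on_replace_block[OF P]) (use assms(2) in \<open>auto simp: disjnt_def\<close>)
    moreover have "A - B \<union> insert a B = insert a A" using sub by auto
    moreover have "B \<noteq> {}" using P partition_onD3 by blast
    then have "{a} \<notin> ?join p" using notin P(2) by (auto simp: p)
    ultimately show "?join p \<in> {R. partition_on (insert a A) R \<and> {a} \<notin> R}" by simp
    have "{C \<in> ?join p. a \<in> C} = {insert a B}"
      using notin by (auto simp: p)
    then have "block (?join p) = B"
      using notin[OF P(2)] by (simp add: block_def)
    \<comment> \<open>Hence removing the enlarged block leaves exactly
      \<open>P - {B}\<close>.\<close>
    moreover have "insert a B \<notin> P" using notin by blast
    ultimately show "?split (?join p) = p"
      using P(2) by (auto simp: p)
  qed
  also have "\<dots> = (\<Sum>P | partition_on A P. \<Sum>B\<in>P. g (insert (insert a B) (P - {B})))"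
    using assms(1) finitely_many_partition_on[OF assms(1)] finite_elements
    by (subst sum.Sigma) (auto simp: case_prod_unfold)
  finally show ?thesis .
qed

text \<open>Case distinction on whether \<open>a\<close> forms a block by itself.\<close>

lemma sum_partition_on_insert:
  assumes "finite A" "a \<notin> A"
  shows "(\<Sum>R | partition_on (insert a A) R. g R) =
    (\<Sum>P | partition_on A P. g (insert {a} P) + (\<Sum>B\<in>P. g (insert (insert a B) (P - {B}))))"
proof -
  let ?S = "{R. partition_on (insert a A) R}"
  have "finite ?S" using assms(1) by (simp add: finitely_many_partition_on)
  then have "sum g ?S = sum g {R \<in> ?S. {a} \<in> R} + sum g {R \<in> ?S. {a} \<notin> R}"
    by (subst sum.union_disjoint[symmetric]) (auto intro: sum.cong)
  also have "sum g {R \<in> ?S. {a} \<in> R} = (\<Sum>P | partition_on A P. g (insert {a} P))"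
  proof (rule sum.reindex_bij_witness[where i = "insert {a}" and j = "\<lambda>R. R - {{a}}"])
    fix R assume "R \<in> {R \<in> ?S. {a} \<in> R}"
    then show "R - {{a}} \<in> {P. partition_on A P}"
      using partition_on_insert_singleton[OF assms(2), of "R - {{a}}"] by (simp add: insert_absorb)
  next
    fix P assume "P \<in> {P. partition_on A P}"
    then show "insert {a} P \<in> {R \<in> ?S. {a} \<in> R}" "insert {a} P - {{a}} = P"
      using partition_on_insert_singleton[OF assms(2), of P] by simp_all
  qed (auto simp: insert_absorb)
  also have "sum g {R \<in> ?S. {a} \<notin> R} =
      (\<Sum>P | partition_on A P. \<Sum>B\<in>P. g (insert (insert a B) (P - {B})))"
    using sum_partition_on_insert_block[OF assms, of g] by simp
  finally show ?thesis by (simp add: sum.distrib)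
qed

text \<open>Blocks are disjoint and each contributes at least one element.\<close>

lemma card_partition_on_le:
  assumes "finite A" "partition_on A P"
  shows "card P \<le> card A"
proof -
  have "card P = (\<Sum>B\<in>P. 1)" by simp
  also have "\<dots> \<le> (\<Sum>B\<in>P. card B)"
  proof (rule sum_mono)
    fix B assume "B \<in> P"
    then have "B \<noteq> {}" "finite B"
      using assms partition_onD3[OF assms(2)] partition_onD1[OF assms(2)]
      by (auto intro: finite_subset)
    then show "1 \<le> card B" by (simp add: Suc_le_eq card_gt_0_iff)
  qed
  also have "\<dots> = card (\<Union>P)"
    using assms partition_onD1[OF assms(2)] partition_onD2[OF assms(2)]
    by (intro card_Union_disjoint[symmetric]) (auto intro: finite_subset)
  finally show ?thesis using partition_onD1[OF assms(2)] by simp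
qed

section \<open>Expansion of \<open>Delta\<close> over set partitions\<close>

text \<open>Leaving the partitions ungrouped gives each its own summand, so the induction step works
  term by term. It starts at \<open>n = 0\<close> with the empty partition and the empty
  product.\<close>

lemma Delta_eq_sum_partitions:
  "Delta n (mfps_of_fps F) = (\<Sum>\<pi> | partition_on {1..n} \<pi>.
     mfps_of_fps ((fps_deriv ^^ card \<pi>) F) * (\<Prod>B\<in>\<pi>. mX (card B)))"
proof (induction n)
  case 0
  show ?case by (simp add: partition_on_empty)
next
  case (Suc n)
  let ?X = "\<lambda>B. mX (card B) :: 'a mfps"
  let ?F = "\<lambda>k. mfps_of_fps ((fps_deriv ^^ k) F)"
  let ?t = "\<lambda>\<pi>. ?F (card \<pi>) * prod ?X \<pi>"
  have step: "D_op (Suc n) (?t \<pi>) = ?t (insert {Suc n} \<pi>)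
      + (\<Sum>B\<in>\<pi>. ?t (insert (insert (Suc n) B) (\<pi> - {B})))"
    if \<pi>: "partition_on {1..n} \<pi>" for \<pi>
  proof -
    have fin: "finite \<pi>" using \<pi> finite_elements by blast
    have sub: "B \<subseteq> {1..n}" if "B \<in> \<pi>" for B
      using \<pi> that by (auto simp: partition_on_def)
    then have notin: "insert (Suc n) B \<notin> \<pi>" for B
      by fastforce
    \<comment> \<open>The new factor \<open>mX 1\<close> belongs to the block
      \<open>{Suc n}\<close>; as this block is not in \<open>\<pi>\<close>, the number of blocks
      rises with the order of the derivative.\<close>
    have "D_op (Suc n) (?F (card \<pi>)) * prod ?X \<pi> = ?t (insert {Suc n} \<pi>)"
      using fin notin[of "{}"] by (simp add: D_op_mfps_of_fps mult_ac)
    moreover have "?F (card \<pi>) * D_op (Suc n) (prod ?X \<pi>) =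
        (\<Sum>B\<in>\<pi>. ?t (insert (insert (Suc n) B) (\<pi> - {B})))"
      unfolding D_op_prod[OF fin] sum_distrib_left
    proof (rule sum.cong)
      fix B assume B: "B \<in> \<pi>"
      \<comment> \<open>\<open>card B \<le> n\<close> places the variable within the range of
        \<open>D_op (Suc n)\<close>, and \<open>Suc n \<notin> B\<close> makes its index rise by
        one.\<close>
      have finB: "finite B" and "Suc n \<notin> B" "card B \<le> n"
        using sub[OF B] finite_subset card_mono[of "{1..n}" B] by auto
      \<comment> \<open>Replacing \<open>B\<close> gives \<open>Suc (card \<pi> - 1)\<close> blocks,
        which is \<open>card \<pi>\<close> since \<open>\<pi>\<close> is nonempty.\<close>
      moreover have "card \<pi> > 0" using B fin by (auto simp: card_gt_0_iff)
      ultimately show "?F (card \<pi>) * (D_op (Suc n) (?X B) * prod ?X (\<pi> - {B})) =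
          ?t (insert (insert (Suc n) B) (\<pi> - {B}))"
        using B fin notin[of B] by (simp add: D_op_mX)
    qed simp
    ultimately show ?thesis by (simp only: D_op_mult)
  qed
  have "Delta (Suc n) (mfps_of_fps F) = (\<Sum>\<pi> | partition_on {1..n} \<pi>. D_op (Suc n) (?t \<pi>))"
    by (simp add: Suc D_op_sum)
  also have "\<dots> = (\<Sum>\<pi> | partition_on {1..n} \<pi>. ?t (insert {Suc n} \<pi>)
      + (\<Sum>B\<in>\<pi>. ?t (insert (insert (Suc n) B) (\<pi> - {B}))))"
    by (rule sum.cong) (simp_all only: step mem_Collect_eq)
  also have "\<dots> = (\<Sum>\<pi> | partition_on (insert (Suc n) {1..n}) \<pi>. ?t \<pi>)"
    by (rule sum_partition_on_insert[symmetric]) auto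
  also have "insert (Suc n) {1..n} = {1..Suc n}" by auto
  finally show ?case .
qed

theorem theorem2:
  fixes \<iota> :: "rat \<Rightarrow> 'a::comm_ring_1"
    and F :: "'a fps"
    and n :: nat
  assumes "ring_embedding \<iota>"
    and "n \<ge> 1"
  shows "Delta n (mfps_of_fps F) =
    (\<Sum>k=1..n. mfps_of_fps ((fps_deriv ^^ k) F) * Bell_poly n k mX)"
proof -
  let ?S = "{\<pi>. partition_on {1..n} \<pi>}"
  let ?t = "\<lambda>\<pi>. mfps_of_fps ((fps_deriv ^^ card \<pi>) F) * (\<Prod>B\<in>\<pi>. mX (card B))"
  have "finite ?S" by (rule finitely_many_partition_on) simp
  \<comment> \<open>As \<open>n \<ge> 1\<close> rules out the empty partition, grouping by block
    counts from 1 to \<open>n\<close> loses no partition.\<close>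
  moreover have "card \<pi> \<in> {1..n}" if "\<pi> \<in> ?S" for \<pi>
  proof -
    from that have \<pi>: "partition_on {1..n} \<pi>" by simp
    with assms(2) have "\<pi> \<noteq> {}" by (auto simp: partition_on_def)
    with \<pi> show ?thesis
      using card_partition_on_le[OF _ \<pi>] finite_elements[OF _ \<pi>]
      by (simp add: Suc_le_eq card_gt_0_iff)
  qed
  ultimately have "(\<Sum>k=1..n. \<Sum>\<pi> | \<pi> \<in> ?S \<and> card \<pi> = k. ?t \<pi>) = sum ?t ?S"
    by (intro sum.group) auto
  then show ?thesis
    by (simp add: Delta_eq_sum_partitions Bell_poly_def sum_distrib_left)
qed

end
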